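(* Let $T$ be the set of all finite binary trees (including the empty tree). There exists a very explicit function $f : T^7 \to T$ that is a bijection from the set of all seven-tuples of trees onto the set of all trees.
   Context: Trees. A tree is a finite binary tree in which the immediate successors (children) of any node are labeled left and right; each node has at most one left child and at most one right child, and even if a node has only one child, that child is designated as left or right. The empty tree, denoted $0$, is allowed; every non-empty tree has a unique root from which every node can be reached by repeatedly passing to children. Write $[t_1,t_2]$ for the tree consisting of a root with left subtree $t_1$ and right subtree $t_2$. Thus every tree is either $0$ or uniquely of the form $[t_1,t_2]$ with $t_1,t_2\in T$. A leaf is a node with no children. Trees are considered up to isomorphism. Patterns. A pattern is a tree in which some (possibly none) of the leaves are labeled with distinct symbols (these labels are unrelated to the left/right designation of children). An instance of a pattern is obtained by replacing each labeled leaf by some tree; the function assigning to each label the corresponding tree is called the substitution leading to the instance. A substitution may have the empty tree $0$ as a value; the corresponding labeled leaf is then removed. Unlabeled nodes are left unchanged. A 7-pattern is a seven-tuple of patterns in which all labels (across all seven components) are distinct; its instances under substitutions are the seven-tuples of trees obtained by replacing every labeled leaf by the image of its label under the substitution. Very explicit functions. A very explicit function $f: T^7\to T$ is one given by (1) a finite indexed family $(\vec p_i)_{i\in I}$ of 7-patterns such that every seven-tuple $\vec t$ of trees is an instance of exactly one $\vec p_i$, under exactly one substitution, and (2) a family $(q_i)_{i\in I}$ of patterns, indexed by the same $I$, such that each $q_i$ contains the same labels as $\vec p_i$. The value $f(\vec t)$ is obtained by finding the unique $i$ and the unique substitution yielding $\vec t$ as an instance of $\vec p_i$, and applying the same substitution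 to $q_i$. *)

theory Defs
  imports Main "HOL-Library.FuncSet"
begin

datatype tree = Empty | Node tree tree

text \<open>Trees in which some leaves carry a label. The constructor \<open>Label\<close> is a labeled leaf;
  an unlabeled leaf is \<open>PNode PEmpty PEmpty\<close>. A labeled node is a leaf by construction;
  that labels do not repeat is imposed by \<open>is_pattern\<close> and \<open>is_pattern7\<close>.\<close>

datatype 'l ptree = PEmpty | Label 'l | PNode "'l ptree" "'l ptree"

fun labels :: "'l ptree \<Rightarrow> 'l list" where
  "labels PEmpty = []"
| "labels (Label x) = [x]"
| "labels (PNode p1 p2) = labels p1 @ labels p2"

fun subst :: "('l \<Rightarrow> tree) \<Rightarrow> 'l ptree \<Rightarrow> tree" where
  "subst \<sigma> PEmpty = Empty"
| "subst \<sigma> (Label x) = \<sigma> x"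
| "subst \<sigma> (PNode p1 p2) = Node (subst \<sigma> p1) (subst \<sigma> p2)"

definition is_pattern :: "'l ptree \<Rightarrow> bool" where
  "is_pattern p \<longleftrightarrow> distinct (labels p)"

type_synonym 'a tup7 = "'a \<times> 'a \<times> 'a \<times> 'a \<times> 'a \<times> 'a \<times> 'a"

fun labels7 :: "'l ptree tup7 \<Rightarrow> 'l list" where
  "labels7 (p1, p2, p3, p4, p5, p6, p7) =
     labels p1 @ labels p2 @ labels p3 @ labels p4 @ labels p5 @ labels p6 @ labels p7"

fun subst7 :: "('l \<Rightarrow> tree) \<Rightarrow> 'l ptree tup7 \<Rightarrow> tree tup7" where
  "subst7 \<sigma> (p1, p2, p3, p4, p5, p6, p7) =
     (subst \<sigma> p1, subst \<sigma> p2, subst \<sigma> p3, subst \<sigma> p4, subst \<sigma> p5, subst \<sigma> p6, subst \<sigma> p7)"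

definition is_pattern7 :: "'l ptree tup7 \<Rightarrow> bool" where
  "is_pattern7 p \<longleftrightarrow> distinct (labels7 p)"

text \<open>A substitution for \<open>p\<close> is a function on the labels of \<open>p\<close> only. Taking it extensional
  makes equality of substitutions mean agreement on those labels.\<close>

definition leads_to :: "'l ptree tup7 \<Rightarrow> ('l \<Rightarrow> tree) \<Rightarrow> tree tup7 \<Rightarrow> bool" where
  "leads_to p \<sigma> t \<longleftrightarrow> \<sigma> \<in> set (labels7 p) \<rightarrow>\<^sub>E UNIV \<and> subst7 \<sigma> p = t"

definition instance7 :: "'l ptree tup7 \<Rightarrow> tree tup7 \<Rightarrow> bool" where
  "instance7 p t \<longleftrightarrow> (\<exists>\<sigma>. leads_to p \<sigma> t)"

text \<open>Index sets and label symbols are drawn from \<open>nat\<close>; as only finitely many of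
  each occur, this is no restriction.\<close>

definition very_explicit :: "(tree tup7 \<Rightarrow> tree) \<Rightarrow> bool" where
  "very_explicit f \<longleftrightarrow>
     (\<exists>(I :: nat set) (p :: nat \<Rightarrow> nat ptree tup7) (q :: nat \<Rightarrow> nat ptree).
        finite I \<and>
        (\<forall>i\<in>I. is_pattern7 (p i)) \<and>
        (\<forall>t. \<exists>!i. i \<in> I \<and> instance7 (p i) t) \<and>
        (\<forall>t. \<forall>i\<in>I. instance7 (p i) t \<longrightarrow> (\<exists>!\<sigma>. leads_to (p i) \<sigma> t)) \<and>
        (\<forall>i\<in>I. is_pattern (q i) \<and> set (labels (q i)) = set (labels7 (p i))) \<and>
        (\<forall>t. \<forall>i\<in>I. \<forall>\<sigma>. leads_to (p i) \<sigma> t \<longrightarrow> f t = subst \<sigma> (q i)))"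

end

theory Submission
  imports Defs "HOL-Library.Multiset"
begin

text \<open>
  Splitting a tree into the cases \<open>Empty\<close> and \<open>Node\<close> is an explicit isomorphism \<open>T = 1 + T\<^sup>2\<close>, hence
  \<open>T\<^bsup>n+1\<^esup> = T\<^bsup>n\<^esup> + T\<^bsup>n+2\<^esup>\<close>. On patterns it replaces a pattern with \<open>n + 1\<close> labels by two
  patterns, with \<open>n\<close> and \<open>n + 2\<close> labels, whose instances partition those of the original one
  (\<open>tileable_split\<close>). Starting from the pattern for all trees (one label) and from the pattern for all
  seven-tuples (seven labels), such splittings lead to finite partitions of \<open>T\<close> and of \<open>T\<^sup>7\<close> into the
  instance sets of patterns. If the multisets of label counts on the two sides agree, the pieces can
  be matched so that partners have equally many labels, and then, after renaming, the same labels.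
  Carrying every instance of a piece to the instance of its partner under the same substitution is a
  very explicit bijection (\<open>very_explicit_bij_of_tilings\<close>).

  In terms of polynomials with natural coefficients, the task is to find a common result of rewriting
  \<open>X\<close> and \<open>X\<^sup>7\<close> by the rule \<open>X\<^bsup>n+1\<^esup> \<rightarrow> X\<^bsup>n\<^esup> + X\<^bsup>n+2\<^esup>\<close>. Splitting \<open>X\<^sup>n\<close> adds \<open>X\<^sup>n (1 - X + X\<^sup>2) / X\<close>, and
  \<open>X - X\<^sup>7 = (X\<^sup>2 + X\<^sup>3 - X\<^sup>5 - X\<^sup>6) (1 - X + X\<^sup>2) / X\<close>,
  so the exponents \<open>2, 3\<close> must be split once more often on the side of \<open>X\<^sup>7\<close>, and \<open>5, 6\<close> once more
  often on the side of \<open>X\<close>. The terms required for these extra splits become available when both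
  sides split each of \<open>1, \<dots>, 7\<close> once, in ascending order from \<open>X\<close> and in descending order from \<open>X\<^sup>7\<close>.
  Both sides then arrive at \<open>1 + X + X\<^sup>2 + X\<^sup>3 + 2 X\<^sup>4 + X\<^sup>5 + X\<^sup>6 + X\<^sup>7 + X\<^sup>8\<close>
  (\<open>tileable_one\<close> and \<open>tileable_seven\<close>).
\<close>

section \<open>Instances of a pattern\<close>

definition instances :: "'l ptree \<Rightarrow> tree set" where
  "instances p = range (\<lambda>\<sigma>. subst \<sigma> p)"

lemma subst_in_instances [simp]: "subst \<sigma> p \<in> instances p"
  by (simp add: instances_def)

text \<open>A substitution can be read off from the instance, since the position of a label in the pattern
  is also the position of its value. Hence the substitution leading to an instance is unique.\<close>

lemma subst_eq_iff: "subst \<sigma> p = subst \<tau> p \<longleftrightarrow> (\<forall>x\<in>set (labels p). \<sigma> x = \<tau> x)"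
  by (induction p) auto

lemma labels_map_ptree: "labels (map_ptree h p) = map h (labels p)"
  by (induction p) auto

lemma subst_map_ptree: "subst \<sigma> (map_ptree h p) = subst (\<sigma> \<circ> h) p"
  by (induction p) auto

text \<open>Which symbols serve as labels is immaterial, only their number counts.\<close>

lemma relabel:
  fixes q :: "'l ptree" and A :: "'m set"
  assumes q: "is_pattern q" and A: "finite A" "card A = length (labels q)"
  shows "\<exists>q'. is_pattern q' \<and> set (labels q') = A \<and> instances q' = instances q"
proof -
  have "card (set (labels q)) = card A"
    using q A by (simp add: is_pattern_def distinct_card)
  then obtain h where h: "bij_betw h (set (labels q)) A"
    using A finite_same_card_bij by blast
  let ?q = "map_ptree h q"
  have inj: "inj_on h (set (labels q))" using h by (rule bij_betw_imp_inj_on)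
  have "instances ?q = instances q"
  proof
    show "instances ?q \<subseteq> instances q"
      by (auto simp: instances_def subst_map_ptree)
    show "instances q \<subseteq> instances ?q"
    proof
      fix t assume "t \<in> instances q"
      then obtain \<sigma> where "t = subst \<sigma> q" by (auto simp: instances_def)
      also have "\<dots> = subst (\<sigma> \<circ> inv_into (set (labels q)) h) ?q"
        using inj by (simp add: subst_map_ptree subst_eq_iff)
      finally show "t \<in> instances ?q" by simp
    qed
  qed
  moreover have "is_pattern ?q"
    using q inj by (simp add: is_pattern_def labels_map_ptree distinct_map)
  moreover have "set (labels ?q) = A"
    using h by (simp add: labels_map_ptree bij_betw_imp_surj_on)
  ultimately show ?thesis by blast
qed

section \<open>Splitting a label\<close>

fun plug :: "'l \<Rightarrow> 'l ptree \<Rightarrow> 'l ptree \<Rightarrow> 'l ptree" where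
  "plug x r PEmpty = PEmpty"
| "plug x r (Label z) = (if z = x then r else Label z)"
| "plug x r (PNode p1 p2) = PNode (plug x r p1) (plug x r p2)"

lemma subst_plug: "subst \<sigma> (plug x r p) = subst (\<sigma>(x := subst \<sigma> r)) p"
  by (induction p) auto

lemma labels_plug:
  "labels (plug x r p) = concat (map (\<lambda>z. if z = x then labels r else [z]) (labels p))"
  by (induction p) auto

lemma labels_plug_once:
  assumes "labels p = as @ x # bs" "x \<notin> set as" "x \<notin> set bs"
  shows "labels (plug x r p) = as @ labels r @ bs"
proof -
  have "concat (map (\<lambda>z. if z = x then labels r else [z]) cs) = cs" if "x \<notin> set cs" for cs
    using that by (induction cs) auto
  then show ?thesis using assms by (simp add: labels_plug)
qed

text \<open>The two halves of \<open>T = 1 + T\<^sup>2\<close>, applied at one label of a pattern. The old symbol is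
  reused for the left child, so only one new symbol \<open>y\<close> is required.\<close>

abbreviation split_empty :: "'l \<Rightarrow> 'l ptree \<Rightarrow> 'l ptree" where
  "split_empty x \<equiv> plug x PEmpty"

abbreviation split_node :: "'l \<Rightarrow> 'l \<Rightarrow> 'l ptree \<Rightarrow> 'l ptree" where
  "split_node x y \<equiv> plug x (PNode (Label x) (Label y))"

lemma split_is_pattern:
  assumes "is_pattern p" "x \<in> set (labels p)" "y \<notin> set (labels p)"
  shows "is_pattern (split_empty x p)" "Suc (length (labels (split_empty x p))) = length (labels p)"
    and "is_pattern (split_node x y p)" "length (labels (split_node x y p)) = Suc (length (labels p))"
proof -
  obtain as bs where l: "labels p = as @ x # bs" using assms(2) split_list by fast
  with assms have "x \<notin> set as" "x \<notin> set bs" by (auto simp: is_pattern_def)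
  note s = labels_plug_once[OF l this]
  show "is_pattern (split_empty x p)" "Suc (length (labels (split_empty x p))) = length (labels p)"
    "is_pattern (split_node x y p)" "length (labels (split_node x y p)) = Suc (length (labels p))"
    using assms l by (auto simp: is_pattern_def s)
qed

lemma instances_split:
  assumes "y \<notin> set (labels p)"
  shows "instances p = instances (split_empty x p) \<union> instances (split_node x y p)"
proof
  show "instances (split_empty x p) \<union> instances (split_node x y p) \<subseteq> instances p"
    by (auto simp: instances_def subst_plug)
  show "instances p \<subseteq> instances (split_empty x p) \<union> instances (split_node x y p)"
  proof
    fix t assume "t \<in> instances p"
    then obtain \<sigma> where t: "t = subst \<sigma> p" by (auto simp: instances_def)
    show "t \<in> instances (split_empty x p) \<union> instances (split_node x y p)"
    proof (cases "\<sigma> x")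
      case Empty
      then have "t = subst \<sigma> (split_empty x p)"
        by (simp add: t subst_plug subst_eq_iff)
      then show ?thesis by simp
    next
      case (Node a b)
      have "t = subst (\<sigma>(y := b, x := a)) (split_node x y p)"
        using assms Node by (auto simp: t subst_plug subst_eq_iff)
      then show ?thesis by (metis UnI2 subst_in_instances)
    qed
  qed
qed

lemma instances_split_disjoint:
  assumes "x \<in> set (labels p)"
  shows "instances (split_empty x p) \<inter> instances (split_node x y p) = {}"
  using assms by (fastforce simp: instances_def subst_plug subst_eq_iff)

section \<open>Partitions into instance sets\<close>

definition tiling :: "tree set \<Rightarrow> nat ptree set \<Rightarrow> bool" where
  "tiling R P \<longleftrightarrow> finite P \<and> (\<forall>p\<in>P. is_pattern p \<and> instances p \<subseteq> R)
     \<and> (\<forall>t\<in>R. \<exists>!p. p \<in> P \<and> t \<in> instances p)"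

text \<open>The multiset \<open>M\<close> plays the role of the polynomial \<open>\<Sum>n\<in>M. X\<^sup>n\<close>.\<close>

definition tileable :: "tree set \<Rightarrow> nat multiset \<Rightarrow> bool" where
  "tileable R M \<longleftrightarrow> (\<exists>P. tiling R P \<and> image_mset (length \<circ> labels) (mset_set P) = M)"

lemma tileable_instances:
  fixes p :: "nat ptree"
  assumes "is_pattern p"
  shows "tileable (instances p) {#length (labels p)#}"
  unfolding tileable_def using assms by (intro exI[of _ "{p}"]) (auto simp: tiling_def)

lemma tiling_disjoint:
  assumes "tiling R P" "p \<in> P" "q \<in> P" "t \<in> instances p" "t \<in> instances q"
  shows "p = q"
  using assms unfolding tiling_def by blast

text \<open>The rewriting rule \<open>X\<^bsup>n+1\<^esup> \<rightarrow> X\<^bsup>n\<^esup> + X\<^bsup>n+2\<^esup>\<close>: refine a piece with \<open>n + 1\<close> labels at any one of them.\<close>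

lemma tileable_split:
  assumes "tileable R (add_mset (Suc n) M)"
  shows "tileable R (add_mset n (add_mset (Suc (Suc n)) M))"
proof -
  obtain P where P: "tiling R P"
      and deg: "image_mset (length \<circ> labels) (mset_set P) = add_mset (Suc n) M"
    using assms by (auto simp: tileable_def)
  have fin: "finite P" using P by (simp add: tiling_def)
  have "Suc n \<in># image_mset (length \<circ> labels) (mset_set P)" by (simp add: deg)
  then obtain p where p: "p \<in> P" "length (labels p) = Suc n"
    using fin by auto
  have pat: "is_pattern p" using P p by (simp add: tiling_def)
  obtain x where x: "x \<in> set (labels p)" using p(2) by (cases "labels p") auto
  obtain y where y: "y \<notin> set (labels p)" using ex_new_if_finite infinite_UNIV_nat by blast
  define p0 p1 where "p0 = split_empty x p" and "p1 = split_node x y p"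
  note s = split_is_pattern[OF pat x y, folded p0_def p1_def]
  have un: "instances p = instances p0 \<union> instances p1"
    unfolding p0_def p1_def by (rule instances_split[OF y])
  have dj: "instances p0 \<inter> instances p1 = {}"
    unfolding p0_def p1_def by (rule instances_split_disjoint[OF x])
  have other: "t \<notin> instances q" if "q \<in> P - {p}" "t \<in> instances p0 \<union> instances p1" for q t
    using tiling_disjoint[OF P p(1), of q t] that un by auto
  \<comment> \<open>Needed for the label counts: the two new pieces do not coincide with each other or an old one.
      Instance sets are never empty, so this follows from disjointness.\<close>
  have new: "p0 \<noteq> p1" "p0 \<notin> P - {p}" "p1 \<notin> P - {p}"
    using dj other subst_in_instances by blast+
  let ?P = "insert p0 (insert p1 (P - {p}))"
  have "tiling R ?P"
    unfolding tiling_def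
  proof (intro conjI ballI)
    fix t assume "t \<in> R"
    then obtain q where q: "q \<in> P" "t \<in> instances q" using P by (auto simp: tiling_def)
    show "\<exists>!q. q \<in> ?P \<and> t \<in> instances q"
    proof (cases "q = p")
      case True
      then have "t \<in> instances p0 \<union> instances p1" using q un by simp
      then show ?thesis using dj other by blast
    next
      case False
      then have "t \<notin> instances p0 \<union> instances p1" using other q by blast
      then show ?thesis using False q tiling_disjoint[OF P] by blast
    qed
  qed (use P p un s fin in \<open>auto simp: tiling_def\<close>)
  moreover have "image_mset (length \<circ> labels) (mset_set ?P) = add_mset n (add_mset (Suc (Suc n)) M)"
  proof -
    have "mset_set P = add_mset p (mset_set (P - {p}))"
      using fin p(1) by (rule mset_set.remove)
    then have "image_mset (length \<circ> labels) (mset_set (P - {p})) = M"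
      using deg p(2) by simp
    moreover have "mset_set ?P = add_mset p0 (add_mset p1 (mset_set (P - {p})))"
      using new fin by simp
    ultimately show ?thesis using s p(2) by simp
  qed
  ultimately show ?thesis by (auto simp: tileable_def)
qed

section \<open>A common refinement of one tree and seven trees\<close>

text \<open>Splitting \<open>1, 2, \<dots>, k\<close> in turn leaves \<open>0, \<dots>, k - 1\<close> behind and moves the top exponent up.\<close>

lemma tileable_ascend:
  assumes "tileable R {#1#}"
  shows "tileable R (add_mset (Suc k) (mset [0..<k]))"
proof (induction k)
  case 0
  show ?case using assms by simp
next
  case (Suc k)
  show ?case using tileable_split[OF Suc] by (simp add: add_mset_commute)
qed

text \<open>The mirror image: splitting \<open>m + k, \<dots>, m + 1\<close> in turn moves the bottom exponent down to \<open>m\<close>.\<close>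

lemma tileable_descend:
  assumes "tileable R {#m + k#}"
  shows "tileable R (add_mset m (mset [m + 2..<m + k + 2]))"
  using assms
proof (induction k arbitrary: m)
  case 0
  then show ?case by simp
next
  case (Suc k)
  have "tileable R (add_mset (Suc m) (mset [Suc m + 2..<Suc m + k + 2]))"
    using Suc.prems by (intro Suc.IH) simp
  from tileable_split[OF this] show ?case
    by (simp add: upt_conv_Cons del: upt_Suc)
qed

text \<open>The meeting point is symmetric under \<open>n \<mapsto> 8 - n\<close>, which exchanges the starting points \<open>1\<close> and \<open>7\<close>
  and respects splitting. The two derivations are mirror images of each other.\<close>

abbreviation common :: "nat multiset" where
  "common \<equiv> {#0, 1, 2, 3, 4, 4, 5, 6, 7, 8#}"

lemma tileable_one:
  assumes "tileable R {#1#}"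
  shows "tileable R common"
proof -
  have "tileable R (add_mset (Suc 7) (mset [0..<7]))"
    using assms by (rule tileable_ascend)
  \<comment> \<open>The extra splits of \<open>5\<close> and \<open>6\<close>; the former makes \<open>6\<close> occur twice.\<close>
  then have "tileable R (add_mset (Suc 4) {#0, 1, 2, 3, 4, 6, 8#})"
    by (simp add: upt_rec numeral_eq_Suc add_mset_commute)
  from tileable_split[OF this] have "tileable R (add_mset (Suc 5) {#0, 1, 2, 3, 4, 4, 6, 8#})"
    by (simp add: numeral_eq_Suc add_mset_commute)
  from tileable_split[OF this] show ?thesis
    by (simp add: numeral_eq_Suc add_mset_commute)
qed

lemma tileable_seven:
  assumes "tileable R {#7#}"
  shows "tileable R common"
proof -
  have "tileable R (add_mset 0 (mset [0 + 2..<0 + 7 + 2]))"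
    by (rule tileable_descend) (use assms in simp)
  \<comment> \<open>The extra splits of \<open>3\<close> and \<open>2\<close>; the former makes \<open>2\<close> occur twice.\<close>
  then have "tileable R (add_mset (Suc 2) {#0, 2, 4, 5, 6, 7, 8#})"
    by (simp add: upt_rec numeral_eq_Suc add_mset_commute)
  from tileable_split[OF this] have "tileable R (add_mset (Suc 1) {#0, 2, 4, 4, 5, 6, 7, 8#})"
    by (simp add: numeral_eq_Suc add_mset_commute)
  from tileable_split[OF this] show ?thesis
    by (simp add: numeral_eq_Suc add_mset_commute)
qed

section \<open>Matching the pieces of two partitions\<close>

text \<open>Sorting the pieces by their number of labels makes two partitions with the same label counts
  correspond index by index.\<close>

lemma tileable_sorted_list:
  assumes "tileable R M"
  shows "\<exists>ps. distinct ps \<and> tiling R (set ps) \<and> map (length \<circ> labels) ps = sorted_list_of_multiset M"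
proof -
  obtain P where P: "tiling R P" "image_mset (length \<circ> labels) (mset_set P) = M"
    using assms by (auto simp: tileable_def)
  have "finite P" using P(1) by (simp add: tiling_def)
  then obtain xs where xs: "set xs = P" "distinct xs"
    using finite_distinct_list by blast
  let ?ps = "sort_key (length \<circ> labels) xs"
  have "mset (map (length \<circ> labels) ?ps) = M"
    using P(2) xs by (simp add: mset_set_set[symmetric])
  then have "map (length \<circ> labels) ?ps = sorted_list_of_multiset M"
    by (metis sort_key_simps sorted_list_of_multiset_mset sorted_sort_key sorted_sort_id)
  with xs P show ?thesis by (intro exI[of _ ?ps]) auto
qed

text \<open>A seven-tuple is viewed as a single tree, so that one notion of partition covers both sides.\<close>

fun tuple_tree :: "tree tup7 \<Rightarrow> tree" where
  "tuple_tree (a, b, c, d, e, f, g) = Node a (Node b (Node c (Node d (Node e (Node f g)))))"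

fun tuple_pattern :: "'l ptree tup7 \<Rightarrow> 'l ptree" where
  "tuple_pattern (a, b, c, d, e, f, g) = PNode a (PNode b (PNode c (PNode d (PNode e (PNode f g)))))"

lemma tuple_tree_eq_iff [simp]: "tuple_tree s = tuple_tree t \<longleftrightarrow> s = t"
  by (cases s; cases t) auto

lemma subst_tuple_pattern: "subst \<sigma> (tuple_pattern p) = tuple_tree (subst7 \<sigma> p)"
  by (cases p) auto

lemma labels_tuple_pattern: "labels (tuple_pattern p) = labels7 p"
  by (cases p) auto

text \<open>Substituting \<open>Empty\<close> everywhere turns labels into \<open>Empty\<close>, so the six nodes on the spine of the
  resulting tuple all come from unlabeled nodes of the pattern. Hence every piece of a partition of
  the seven-tuples can be read as a 7-pattern.\<close>

lemma tuple_patternI: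
  assumes "instances p \<subseteq> range tuple_tree"
  shows "\<exists>p'. p = tuple_pattern p'"
proof -
  have spine: "\<exists>p1 p2. p = PNode p1 p2 \<and> subst (\<lambda>_. Empty) p1 = a \<and> subst (\<lambda>_. Empty) p2 = b"
    if "subst (\<lambda>_. Empty) p = Node a b" for p :: "'a ptree" and a b
    using that by (cases p) auto
  have "subst (\<lambda>_. Empty) p \<in> range tuple_tree" using assms by auto
  then obtain a b c d e f g
    where "subst (\<lambda>_. Empty) p = Node a (Node b (Node c (Node d (Node e (Node f g)))))"
    by auto
  then obtain p1 p2 p3 p4 p5 p6 p7 where "p = tuple_pattern (p1, p2, p3, p4, p5, p6, p7)"
    by (auto dest!: spine)
  then show ?thesis ..
qed

lemma instance7_iff: "instance7 p t \<longleftrightarrow> tuple_tree t \<in> instances (tuple_pattern p)"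
proof
  assume "instance7 p t"
  then show "tuple_tree t \<in> instances (tuple_pattern p)"
    by (auto simp: instance7_def leads_to_def subst_tuple_pattern[symmetric])
next
  assume "tuple_tree t \<in> instances (tuple_pattern p)"
  then obtain \<sigma> where \<sigma>: "tuple_tree t = subst \<sigma> (tuple_pattern p)"
    by (auto simp: instances_def)
  also have "\<dots> = subst (restrict \<sigma> (set (labels7 p))) (tuple_pattern p)"
    by (auto simp: subst_eq_iff labels_tuple_pattern)
  finally have "leads_to p (restrict \<sigma> (set (labels7 p))) t"
    by (simp add: leads_to_def subst_tuple_pattern)
  then show "instance7 p t" by (auto simp: instance7_def)
qed

lemma leads_to_unique:
  assumes "leads_to p \<sigma> t" "leads_to p \<tau> t"
  shows "\<sigma> = \<tau>"
proof -
  have "subst \<sigma> (tuple_pattern p) = subst \<tau> (tuple_pattern p)"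
    using assms by (simp add: leads_to_def subst_tuple_pattern)
  then have "\<forall>x\<in>set (labels7 p). \<sigma> x = \<tau> x"
    by (simp add: subst_eq_iff labels_tuple_pattern)
  then show ?thesis using assms unfolding leads_to_def by (blast intro: PiE_ext)
qed

text \<open>That the 7-patterns partition \<open>T\<^sup>7\<close> makes the matching of pieces a function; that the patterns
  on the other side partition \<open>T\<close> makes it a bijection.\<close>

lemma very_explicit_bij_of_tilings:
  assumes "tileable (range tuple_tree) M" "tileable UNIV M"
  shows "\<exists>f. very_explicit f \<and> bij f"
proof -
  obtain ps where ps: "distinct ps" "tiling (range tuple_tree) (set ps)"
      "map (length \<circ> labels) ps = sorted_list_of_multiset M"
    using tileable_sorted_list[OF assms(1)] by blast
  obtain qs where qs: "distinct qs" "tiling UNIV (set qs)"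
      "map (length \<circ> labels) qs = sorted_list_of_multiset M"
    using tileable_sorted_list[OF assms(2)] by blast
  let ?I = "{..<length ps}"
  have len: "length qs = length ps" using ps(3) qs(3) by (metis length_map)
  have deg: "length (labels (qs ! i)) = length (labels (ps ! i))" if "i \<in> ?I" for i
    using that len ps(3) qs(3) by (metis (no_types, lifting) comp_apply lessThan_iff nth_map)
  have "\<exists>p'. ps ! i = tuple_pattern p'" if "i \<in> ?I" for i
    using that ps(2) by (intro tuple_patternI) (auto simp: tiling_def)
  then obtain p where p: "\<And>i. i \<in> ?I \<Longrightarrow> ps ! i = tuple_pattern (p i)" by metis
  have pat: "is_pattern7 (p i)" if "i \<in> ?I" for i
  proof -
    have "is_pattern (ps ! i)" using that ps(2) by (simp add: tiling_def)
    then show ?thesis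
      using that by (simp add: p is_pattern_def is_pattern7_def labels_tuple_pattern)
  qed
  have "\<exists>q'. is_pattern q' \<and> set (labels q') = set (labels7 (p i)) \<and> instances q' = instances (qs ! i)"
    if i: "i \<in> ?I" for i
  proof (rule relabel)
    show "is_pattern (qs ! i)" using i qs(2) len by (simp add: tiling_def)
    show "card (set (labels7 (p i))) = length (labels (qs ! i))"
      using pat[OF i] deg[OF i] p[OF i]
      by (simp add: is_pattern7_def distinct_card labels_tuple_pattern)
  qed simp
  then obtain q where q: "\<And>i. i \<in> ?I \<Longrightarrow> is_pattern (q i)"
      "\<And>i. i \<in> ?I \<Longrightarrow> set (labels (q i)) = set (labels7 (p i))"
      "\<And>i. i \<in> ?I \<Longrightarrow> instances (q i) = instances (qs ! i)"
    by metis
  have ex1_p: "\<exists>!i. i \<in> ?I \<and> instance7 (p i) t" for t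
  proof -
    have "\<forall>u\<in>range tuple_tree. \<exists>!r. r \<in> set ps \<and> u \<in> instances r"
      using ps(2) unfolding tiling_def by (elim conjE)
    then have "\<exists>!r. r \<in> set ps \<and> tuple_tree t \<in> instances r"
      by (rule bspec) (rule rangeI)
    then have "\<exists>!i. i \<in> ?I \<and> tuple_tree t \<in> instances (ps ! i)"
      using ps(1) by (metis in_set_conv_nth lessThan_iff nth_eq_iff_index_eq)
    then show ?thesis using p by (metis instance7_iff)
  qed
  have ex1_q: "\<exists>!i. i \<in> ?I \<and> t \<in> instances (q i)" for t
  proof -
    have "\<exists>!r. r \<in> set qs \<and> t \<in> instances r" using qs(2) by (simp add: tiling_def)
    then have "\<exists>!i. i \<in> ?I \<and> t \<in> instances (qs ! i)"
      using qs(1) len by (metis in_set_conv_nth lessThan_iff nth_eq_iff_index_eq)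
    then show ?thesis using q by metis
  qed
  have "\<exists>i \<sigma>. i \<in> ?I \<and> leads_to (p i) \<sigma> t" for t
    using ex1_p[of t] by (auto simp: instance7_def)
  then obtain idx sub where idx: "\<And>t. idx t \<in> ?I" and sub: "\<And>t. leads_to (p (idx t)) (sub t) t"
    by metis
  define f where "f t = subst (sub t) (q (idx t))" for t
  have f: "f t = subst \<sigma> (q i)" if "i \<in> ?I" "leads_to (p i) \<sigma> t" for t i \<sigma>
  proof -
    have "i = idx t" using that idx sub ex1_p[of t] unfolding instance7_def by blast
    moreover from this have "\<sigma> = sub t" using that sub leads_to_unique by blast
    ultimately show ?thesis by (simp add: f_def)
  qed
  have "\<exists>!\<sigma>. leads_to (p i) \<sigma> t" if "instance7 (p i) t" for i t
    using that leads_to_unique unfolding instance7_def by blast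
  then have "very_explicit f"
    unfolding very_explicit_def using pat ex1_p q(1,2) f
    by (intro exI[of _ ?I] exI[of _ p] exI[of _ q]) blast
  moreover have "inj f"
  proof (rule injI)
    fix s t assume eq: "f s = f t"
    have i: "idx s = idx t"
      using eq idx ex1_q[of "f t"] by (metis f_def subst_in_instances)
    then have "\<forall>x\<in>set (labels7 (p (idx t))). sub s x = sub t x"
      using eq q(2)[OF idx] by (simp add: f_def subst_eq_iff)
    then have "subst (sub s) (tuple_pattern (p (idx t))) = subst (sub t) (tuple_pattern (p (idx t)))"
      by (simp add: subst_eq_iff labels_tuple_pattern)
    then show "s = t"
      using sub[of s] sub[of t] i by (simp add: leads_to_def subst_tuple_pattern)
  qed
  moreover have "surj f"
    unfolding surj_def
  proof
    fix t
    obtain i \<sigma> where i: "i \<in> ?I" and t: "t = subst \<sigma> (q i)"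
      using ex1_q[of t] by (auto simp: instances_def)
    \<comment> \<open>Substitutions for a 7-pattern are extensional.\<close>
    let ?\<sigma> = "restrict \<sigma> (set (labels7 (p i)))"
    have "f (subst7 ?\<sigma> (p i)) = subst ?\<sigma> (q i)"
      using i by (rule f) (simp add: leads_to_def)
    also have "\<dots> = t"
      using q(2)[OF i] by (auto simp: t subst_eq_iff)
    finally show "\<exists>s. t = f s" by metis
  qed
  ultimately show ?thesis by (auto simp: bij_def)
qed

section \<open>Seven trees in one\<close>

theorem theorem1: "\<exists>f :: tree tup7 \<Rightarrow> tree. very_explicit f \<and> bij f"
proof (rule very_explicit_bij_of_tilings)
  let ?p = "tuple_pattern (Label 0, Label 1, Label 2, Label 3, Label 4, Label 5, Label 6) :: nat ptree"
  have "range tuple_tree = instances ?p"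
  proof
    show "range tuple_tree \<subseteq> instances ?p"
    proof safe
      fix a b c d e f g :: tree
      have "tuple_tree (a, b, c, d, e, f, g) = subst ((!) [a, b, c, d, e, f, g]) ?p" by simp
      then show "tuple_tree (a, b, c, d, e, f, g) \<in> instances ?p" by (metis subst_in_instances)
    qed
    show "instances ?p \<subseteq> range tuple_tree"
      unfolding instances_def subst_tuple_pattern by blast
  qed
  moreover have "tileable (instances ?p) {#7#}"
    using tileable_instances[of ?p] by (simp add: is_pattern_def numeral_eq_Suc)
  ultimately show "tileable (range tuple_tree) common" by (simp only: tileable_seven)
  have "t \<in> instances (Label (0::nat))" for t
    using subst_in_instances[of "\<lambda>_. t" "Label (0::nat)"] by simp
  then have "instances (Label (0::nat)) = UNIV"
    by blast
  then have "tileable UNIV {#1#}"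
    using tileable_instances[of "Label (0::nat)"] by (simp add: is_pattern_def)
  then show "tileable UNIV common" by (rule tileable_one)
qed

end
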